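(* Let $D$ be an integral domain. The $b$-topology and the Zariski topology coincide on the set $\mathrm{Overr}_{ic}(D)$ of integrally closed overrings of $D$.
   Context: Let $K$ be the quotient field of $D$. An overring of $D$ is a ring $T$ with $D\subseteq T\subseteq K$; $\mathrm{Overr}_{ic}(D)$ is the set of integrally closed overrings of $D$. The Zariski topology on $\mathrm{Overr}_{ic}(D)$ is the one with basic open sets $\mathrm{Overr}_{ic}(D[x_1,\dots,x_n])=\{T\in\mathrm{Overr}_{ic}(D)\mid x_1,\dots,x_n\in T\}$, for $x_1,\dots,x_n\in K$. For an overring $T$ of $D$, $\mathrm{Zar}(T)$ is the set of valuation overrings of $T$ (valuation domains $V$ with $T\subseteq V\subseteq K$, including $K$), and for a nonzero $D$-submodule $E$ of $K$, $E^{b(T)}:=\bigcap\{EV\mid V\in\mathrm{Zar}(T)\}$. The $b$-topology on $\mathrm{Overr}_{ic}(D)$ is the topology having as a subbasis of open sets the sets $\mathscr U_{ic}(F,G):=\{T\in\mathrm{Overr}_{ic}(D)\mid F\subseteq G^{b(T)}\}$, where $F$ and $G$ range among the nonzero finitely generated $D$-submodules of $K$. *)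

theory Defs
  imports
    "HOL-Analysis.Function_Topology"
    "HOL-Computational_Algebra.Polynomial"
    "HOL-Computational_Algebra.Fraction_Field"
begin

text \<open>
  The field \<open>K\<close> is the whole type \<open>'k\<close>; the domain \<open>D\<close> and its overrings
  are subsets of it.
\<close>

definition is_subring :: "'k::field set \<Rightarrow> bool" where
  "is_subring R \<longleftrightarrow> 0 \<in> R \<and> 1 \<in> R \<and> (\<forall>x\<in>R. \<forall>y\<in>R. x + y \<in> R \<and> x * y \<in> R \<and> - x \<in> R)"

definition quotient_field_is_UNIV :: "'k::field set \<Rightarrow> bool" where
  "quotient_field_is_UNIV D \<longleftrightarrow> (\<forall>x. \<exists>a\<in>D. \<exists>b\<in>D. b \<noteq> 0 \<and> x = a / b)"

text \<open>
  Every integral domain, given as a type of class \<^class>\<open>idom\<close>, arises in this way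
  inside its library fraction field.
\<close>

lemma idom_in_fract:
  defines "D \<equiv> range (\<lambda>a::'a::idom. Fract a 1)"
  shows "is_subring D" "quotient_field_is_UNIV D"
proof -
  have "Fract a 1 + Fract b 1 \<in> D" "Fract a 1 * Fract b 1 \<in> D" "- Fract a 1 \<in> D" for a b :: 'a
    by (auto simp: D_def)
  moreover have "0 \<in> D" "1 \<in> D"
    by (auto simp: D_def Zero_fract_def One_fract_def)
  ultimately show "is_subring D"
    by (auto simp: is_subring_def D_def)
  show "quotient_field_is_UNIV D"
    unfolding quotient_field_is_UNIV_def
  proof
    fix x :: "'a fract"
    obtain a b where "x = Fract a b" "b \<noteq> 0"
      by (cases x) auto
    then have "Fract b 1 \<noteq> 0" "x = Fract a 1 / Fract b 1"
      by (simp_all add: Zero_fract_def eq_fract)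
    then show "\<exists>a\<in>D. \<exists>b\<in>D. b \<noteq> 0 \<and> x = a / b"
      by (auto simp: D_def)
  qed
qed

definition overrings :: "'k::field set \<Rightarrow> 'k set set" where
  "overrings D = {T. is_subring T \<and> D \<subseteq> T}"

definition integral_over :: "'k::field set \<Rightarrow> 'k \<Rightarrow> bool" where
  "integral_over T x \<longleftrightarrow> (\<exists>p. lead_coeff p = 1 \<and> (\<forall>i. coeff p i \<in> T) \<and> poly p x = 0)"

text \<open>
  Integral closedness in \<open>K\<close>. For an overring of \<open>D\<close> the quotient field is \<open>K\<close>, so this
  is integral closedness in the usual absolute sense.
\<close>

definition integrally_closed :: "'k::field set \<Rightarrow> bool" where
  "integrally_closed T \<longleftrightarrow> (\<forall>x. integral_over T x \<longrightarrow> x \<in> T)"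

definition Overr_ic :: "'k::field set \<Rightarrow> 'k set set" where
  "Overr_ic D = {T \<in> overrings D. integrally_closed T}"

text \<open>Valuation domains with quotient field \<open>K\<close> containing \<open>T\<close>; \<open>K\<close> itself is included.\<close>

definition Zar :: "'k::field set \<Rightarrow> 'k set set" where
  "Zar T = {V \<in> overrings T. \<forall>x. x \<noteq> 0 \<longrightarrow> x \<in> V \<or> inverse x \<in> V}"

text \<open>The product \<open>EV\<close>: finite sums of products \<open>e v\<close> with \<open>e \<in> E\<close> and \<open>v \<in> V\<close>.\<close>

definition mod_prod :: "'k::field set \<Rightarrow> 'k set \<Rightarrow> 'k set" where
  "mod_prod E V =
     {x. \<exists>(n::nat) e v. (\<forall>i<n. e i \<in> E \<and> v i \<in> V) \<and> x = (\<Sum>i<n. e i * v i)}"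

definition b_closure :: "'k::field set \<Rightarrow> 'k set \<Rightarrow> 'k set" where
  "b_closure T E = (\<Inter>V\<in>Zar T. mod_prod E V)"

definition fg_submodules :: "'k::field set \<Rightarrow> 'k set set" where
  "fg_submodules D =
     {E. \<exists>S. finite S \<and> E = {x. \<exists>c. (\<forall>s\<in>S. c s \<in> D) \<and> x = (\<Sum>s\<in>S. c s * s)}}"

definition zariski_basic_open :: "'k::field set \<Rightarrow> 'k set \<Rightarrow> 'k set set" where
  "zariski_basic_open D X = {T \<in> Overr_ic D. X \<subseteq> T}"

definition zariski_topology :: "'k::field set \<Rightarrow> 'k set topology" where
  "zariski_topology D = topology_generated_by {zariski_basic_open D X | X. finite X}"

definition U_ic :: "'k::field set \<Rightarrow> 'k set \<Rightarrow> 'k set \<Rightarrow> 'k set set" where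
  "U_ic D F G = {T \<in> Overr_ic D. F \<subseteq> b_closure T G}"

definition b_topology :: "'k::field set \<Rightarrow> 'k set topology" where
  "b_topology D = topology_generated_by
     {U_ic D F G | F G. F \<in> fg_submodules D \<and> F \<noteq> {0} \<and> G \<in> fg_submodules D \<and> G \<noteq> {0}}"

text \<open>Both are topologies on \<open>Overr_ic D\<close>, and the Zariski basic open sets form a basis.\<close>

lemma topspace_zariski_topology: "topspace (zariski_topology D) = Overr_ic D"
proof -
  have "zariski_basic_open D {} = Overr_ic D"
    by (simp add: zariski_basic_open_def)
  then have "Overr_ic D \<in> {zariski_basic_open D X | X. finite X}"
    by (metis (mono_tags, lifting) finite.emptyI mem_Collect_eq)
  moreover have "zariski_basic_open D X \<subseteq> Overr_ic D" for X
    by (auto simp: zariski_basic_open_def)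
  ultimately show ?thesis
    unfolding zariski_topology_def topology_generated_by_topspace by blast
qed

lemma openin_zariski_topology:
  "openin (zariski_topology D) U \<longleftrightarrow>
     (\<exists>\<X>. (\<forall>X\<in>\<X>. finite X) \<and> U = (\<Union>X\<in>\<X>. zariski_basic_open D X))"
proof
  assume "openin (zariski_topology D) U"
  then have "generate_topology_on {zariski_basic_open D X | X. finite X} U"
    unfolding zariski_topology_def by (rule openin_topology_generated_by)
  then show "\<exists>\<X>. (\<forall>X\<in>\<X>. finite X) \<and> U = (\<Union>X\<in>\<X>. zariski_basic_open D X)"
  proof (induction)
    case Empty
    show ?case by (rule exI[of _ "{}"]) simp
  next
    case (Int A B)
    then obtain \<A> \<B> where *: "\<forall>X\<in>\<A>. finite X" "A = (\<Union>X\<in>\<A>. zariski_basic_open D X)"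
      "\<forall>X\<in>\<B>. finite X" "B = (\<Union>X\<in>\<B>. zariski_basic_open D X)"
      by blast
    have "A \<inter> B = (\<Union>X\<in>{X \<union> Y | X Y. X \<in> \<A> \<and> Y \<in> \<B>}. zariski_basic_open D X)"
      unfolding * zariski_basic_open_def by (auto; blast)
    moreover have "\<forall>X\<in>{X \<union> Y | X Y. X \<in> \<A> \<and> Y \<in> \<B>}. finite X"
      using * by auto
    ultimately show ?case by blast
  next
    case (UN \<K>)
    then obtain f where "\<And>k. k \<in> \<K> \<Longrightarrow>
        (\<forall>X\<in>f k. finite X) \<and> k = (\<Union>X\<in>f k. zariski_basic_open D X)"
      by metis
    then have "(\<forall>X\<in>\<Union>(f ` \<K>). finite X) \<and> \<Union>\<K> = (\<Union>X\<in>\<Union>(f ` \<K>). zariski_basic_open D X)"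
      by (auto 0 3)
    then show ?case by blast
  next
    case (Basis s)
    then obtain X where "finite X" "s = zariski_basic_open D X" by blast
    then show ?case by (intro exI[of _ "{X}"]) simp
  qed
next
  assume "\<exists>\<X>. (\<forall>X\<in>\<X>. finite X) \<and> U = (\<Union>X\<in>\<X>. zariski_basic_open D X)"
  then show "openin (zariski_topology D) U"
    unfolding zariski_topology_def
    by (elim exE conjE, hypsubst, intro openin_Union)
      (auto intro!: topology_generated_by_Basis)
qed

lemma topspace_b_topology:
  assumes "is_subring D"
  shows "topspace (b_topology D) = Overr_ic D"
proof -
  have "D = {x. \<exists>c. (\<forall>s\<in>{1}. c s \<in> D) \<and> x = (\<Sum>s\<in>{1}. c s * s)}"
    by (auto intro: exI[of _ "\<lambda>_. x" for x])
  then have D: "D \<in> fg_submodules D"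
    unfolding fg_submodules_def by blast
  have D0: "D \<noteq> {0}"
    using assms by (auto simp: is_subring_def)
  have "D \<subseteq> mod_prod D V" if "is_subring V" for V
  proof
    fix x assume "x \<in> D"
    with that have "(\<forall>i<1::nat. x \<in> D \<and> 1 \<in> V) \<and> x = (\<Sum>i<1::nat. x * 1)"
      by (simp add: is_subring_def)
    then show "x \<in> mod_prod D V"
      unfolding mod_prod_def by (intro CollectI exI[of _ "1::nat"] exI[of _ "\<lambda>_. x"] exI[of _ "\<lambda>_. 1"])
  qed
  then have "U_ic D D D = Overr_ic D"
    by (auto simp: U_ic_def b_closure_def Zar_def overrings_def)
  then have "Overr_ic D \<in> {U_ic D F G | F G.
      F \<in> fg_submodules D \<and> F \<noteq> {0} \<and> G \<in> fg_submodules D \<and> G \<noteq> {0}}"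
    using D D0 by blast
  moreover have "U_ic D F G \<subseteq> Overr_ic D" for F G
    by (auto simp: U_ic_def)
  ultimately show ?thesis
    unfolding b_topology_def topology_generated_by_topspace by blast
qed

end

theory Submission
  imports Defs
begin

text \<open>
  Everything rests on a description of the \<open>b\<close>-closure in which no valuation ring occurs
  (\<open>b_closure_iff\<close>): if \<open>T\<close> is an overring of \<open>D\<close>, \<open>G\<close> is the \<open>D\<close>-module spanned by \<open>S\<close>, and
  \<open>f \<noteq> 0\<close>, then \<open>f\<close> lies in the \<open>b(T)\<close>-closure of \<open>G\<close> if and only if
  \<open>f \<in> S \<cdot> T[s/f | s \<in> S]\<close>. One direction is elementary. If a valuation ring \<open>V \<supseteq> T\<close> contains all
  the \<open>s/f\<close>, then it contains \<open>T[s/f | s \<in> S]\<close>, so \<open>f \<in> SV\<close>; if it misses some \<open>s/f\<close>, then it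
  contains \<open>f/s\<close> and \<open>f = s (f/s) \<in> SV\<close>. For the other direction, \<open>f \<notin> S \<cdot> T[s/f | s \<in> S]\<close> means
  that the elements \<open>s/f\<close> do not generate the unit ideal in \<open>T[s/f | s \<in> S]\<close>, and by Chevalley's
  extension theorem (\<open>valuation_extension\<close>) they still do not generate the unit ideal in some
  valuation ring \<open>V\<close> above, that is, \<open>f \<notin> SV\<close>.

  Both inclusions between the topologies follow. The criterion is a finite relation, so it uses only
  finitely many elements of \<open>T\<close> and persists in every overring that contains them
  (\<open>b_closure_spreads\<close>). As \<open>F\<close> has finitely many generators, every subbasic open set of the
  \<open>b\<close>-topology is therefore a union of Zariski basic open sets. Conversely, for \<open>S = {1}\<close> the
  criterion reads \<open>f \<in> T[1/f]\<close>, which says that \<open>f\<close> is integral over \<open>T\<close>. Hence the \<open>b(T)\<close>-closure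
  of \<open>D\<close> is \<open>T\<close> when \<open>T\<close> is integrally closed (\<open>b_closure_base_ring\<close>, Krull's theorem), and
  for \<open>x \<noteq> 0\<close> the set \<open>{T. x \<in> T}\<close> is the subbasic open set that belongs to \<open>F = Dx\<close> and \<open>G = D\<close>.
\<close>

section \<open>Subrings and the modules they generate\<close>

text \<open>
  Generating the subring from below, rather than as an intersection, makes it evident that each of its
  elements involves only finitely many generators.
\<close>

inductive_set subring_gen :: "'k::field set \<Rightarrow> 'k set" for S where
  gen_base: "x \<in> S \<Longrightarrow> x \<in> subring_gen S"
| gen_zero: "0 \<in> subring_gen S"
| gen_one: "1 \<in> subring_gen S"
| gen_add: "x \<in> subring_gen S \<Longrightarrow> y \<in> subring_gen S \<Longrightarrow> x + y \<in> subring_gen S"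
| gen_mult: "x \<in> subring_gen S \<Longrightarrow> y \<in> subring_gen S \<Longrightarrow> x * y \<in> subring_gen S"
| gen_minus: "x \<in> subring_gen S \<Longrightarrow> - x \<in> subring_gen S"

lemma is_subring_subring_gen: "is_subring (subring_gen S)"
  by (auto simp: is_subring_def intro: subring_gen.intros)

lemma subset_subring_gen: "S \<subseteq> subring_gen S"
  by (auto intro: gen_base)

lemma subring_gen_least:
  assumes "is_subring R" "S \<subseteq> R"
  shows "subring_gen S \<subseteq> R"
proof
  fix x assume "x \<in> subring_gen S"
  then show "x \<in> R"
    by induction (use assms in \<open>auto simp: is_subring_def\<close>)
qed

lemma subring_gen_mono: "S \<subseteq> S' \<Longrightarrow> subring_gen S \<subseteq> subring_gen S'"
  by (meson is_subring_subring_gen subring_gen_least subset_subring_gen subset_trans)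

text \<open>
  Later, the finitely many generators that occur in one relation become the coordinates of a Zariski
  neighbourhood.
\<close>

lemma subring_gen_finitary:
  assumes "x \<in> subring_gen S"
  shows "\<exists>X. finite X \<and> X \<subseteq> S \<and> x \<in> subring_gen X"
  using assms
proof induction
  case (gen_base x)
  then show ?case
    by (intro exI[of _ "{x}"]) (auto intro: subring_gen.gen_base)
next
  case (gen_add x y)
  then obtain X Y where "finite X" "X \<subseteq> S" "x \<in> subring_gen X"
    "finite Y" "Y \<subseteq> S" "y \<in> subring_gen Y" by blast
  then show ?case
    using subring_gen_mono[of X "X \<union> Y"] subring_gen_mono[of Y "X \<union> Y"]
    by (intro exI[of _ "X \<union> Y"]) (auto intro: subring_gen.gen_add)
next
  case (gen_mult x y)
  then obtain X Y where "finite X" "X \<subseteq> S" "x \<in> subring_gen X"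
    "finite Y" "Y \<subseteq> S" "y \<in> subring_gen Y" by blast
  then show ?case
    using subring_gen_mono[of X "X \<union> Y"] subring_gen_mono[of Y "X \<union> Y"]
    by (intro exI[of _ "X \<union> Y"]) (auto intro: subring_gen.gen_mult)
qed (blast intro: subring_gen.intros)+

lemma subring_power: "is_subring R \<Longrightarrow> x \<in> R \<Longrightarrow> x ^ n \<in> R"
  by (induction n) (auto simp: is_subring_def)

lemma subring_sum:
  "is_subring A \<Longrightarrow> (\<And>i. i \<in> J \<Longrightarrow> f i \<in> A) \<Longrightarrow> sum f J \<in> A"
  by (induction J rule: infinite_finite_induct) (auto simp: is_subring_def)

lemma zero_in_mod_prod: "0 \<in> mod_prod E V"
  unfolding mod_prod_def by (rule CollectI, rule exI[of _ 0]) simp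

lemma mod_prod_step:
  assumes "e \<in> E" "v \<in> V" "x \<in> mod_prod E V"
  shows "e * v + x \<in> mod_prod E V"
proof -
  obtain n e' v' where *: "\<forall>i<n. e' i \<in> E \<and> v' i \<in> V" "x = (\<Sum>i<n::nat. e' i * v' i)"
    using assms(3) unfolding mod_prod_def by blast
  show ?thesis
    unfolding mod_prod_def
    by (rule CollectI, rule exI[of _ "Suc n"], rule exI[of _ "e'(n := e)"],
        rule exI[of _ "v'(n := v)"])
      (use assms(1,2) * in \<open>auto simp: less_Suc_eq\<close>)
qed

lemma mod_prod_induct [consumes 1, case_names zero step]:
  assumes "x \<in> mod_prod E V"
    and "P 0"
    and "\<And>e v y. e \<in> E \<Longrightarrow> v \<in> V \<Longrightarrow> y \<in> mod_prod E V \<Longrightarrow> P y \<Longrightarrow> P (e * v + y)"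
  shows "P x"
proof -
  have "(\<Sum>i<n. e i * v i) \<in> mod_prod E V \<and> P (\<Sum>i<n. e i * v i)"
    if "\<forall>i<n. e i \<in> E \<and> v i \<in> V" for n :: nat and e v
    using that
  proof (induction n)
    case 0
    then show ?case using assms(2) by (simp add: zero_in_mod_prod)
  next
    case (Suc n)
    then have "(\<Sum>i<n. e i * v i) \<in> mod_prod E V" "P (\<Sum>i<n. e i * v i)" "e n \<in> E" "v n \<in> V"
      by auto
    then show ?case
      using assms(3)[of "e n" "v n"] mod_prod_step[of "e n" E "v n" V] by (simp add: add.commute[of _ "e n * v n"])
  qed
  then show ?thesis
    using assms(1) unfolding mod_prod_def by blast
qed

lemma mult_in_mod_prod: "e \<in> E \<Longrightarrow> v \<in> V \<Longrightarrow> e * v \<in> mod_prod E V"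
  using mod_prod_step[OF _ _ zero_in_mod_prod] by fastforce

lemma mod_prod_add: "x \<in> mod_prod E V \<Longrightarrow> y \<in> mod_prod E V \<Longrightarrow> x + y \<in> mod_prod E V"
  by (induction rule: mod_prod_induct) (auto simp: add.assoc intro: mod_prod_step)

lemma mod_prod_scale:
  assumes "is_subring V" "a \<in> V" "x \<in> mod_prod E V"
  shows "a * x \<in> mod_prod E V"
  using assms(3)
proof (induction rule: mod_prod_induct)
  case (step e v y)
  have "a * (e * v + y) = e * (a * v) + a * y" by (simp add: algebra_simps)
  moreover have "a * v \<in> V" using assms step by (auto simp: is_subring_def)
  ultimately show ?case using step by (simp add: mod_prod_step)
qed (simp add: zero_in_mod_prod)

lemma mod_prod_diff:
  assumes "is_subring V" "x \<in> mod_prod E V" "y \<in> mod_prod E V"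
  shows "x - y \<in> mod_prod E V"
proof -
  have "- 1 \<in> V" using assms(1) unfolding is_subring_def by blast
  then have "- 1 * y \<in> mod_prod E V" using assms mod_prod_scale by blast
  then show ?thesis using mod_prod_add[OF assms(2)] by fastforce
qed

lemma mod_prod_sum:
  "(\<And>i. i \<in> J \<Longrightarrow> f i \<in> mod_prod E V) \<Longrightarrow> sum f J \<in> mod_prod E V"
  by (induction J rule: infinite_finite_induct) (auto simp: zero_in_mod_prod mod_prod_add)

lemma mod_prod_mono:
  assumes "E \<subseteq> E'" "V \<subseteq> V'"
  shows "mod_prod E V \<subseteq> mod_prod E' V'"
proof
  fix x assume "x \<in> mod_prod E V"
  then show "x \<in> mod_prod E' V'"
    by (induction rule: mod_prod_induct)
      (use assms in \<open>auto simp: zero_in_mod_prod intro!: mod_prod_step\<close>)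
qed

lemma mod_prod_subset_ring:
  assumes "is_subring V" "E \<subseteq> V"
  shows "mod_prod E V \<subseteq> V"
proof
  fix x assume "x \<in> mod_prod E V"
  then show "x \<in> V"
    by (induction rule: mod_prod_induct) (use assms in \<open>auto simp: is_subring_def\<close>)
qed

lemma mod_prod_one:
  assumes "is_subring V"
  shows "mod_prod {1} V = V"
  using mod_prod_subset_ring[OF assms, of "{1}"] mult_in_mod_prod[of 1 "{1}" _ V] assms
  by (auto simp: is_subring_def)

lemma mod_prod_image_mult:
  assumes "x \<in> mod_prod E V"
  shows "c * x \<in> mod_prod ((*) c ` E) V"
  using assms
proof (induction rule: mod_prod_induct)
  case (step e v y)
  then have "(c * e) * v + c * y \<in> mod_prod ((*) c ` E) V" by (intro mod_prod_step) auto
  then show ?case by (simp add: algebra_simps)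
qed (simp add: zero_in_mod_prod)

text \<open>
  Dividing a relation \<open>f = \<Sum> s v\<close> by \<open>f\<close> turns membership in a module into the statement that an
  ideal is the unit ideal, which is the form in which it can be tested by valuation rings.
\<close>

lemma one_in_mod_prod_divide_iff:
  assumes "f \<noteq> 0"
  shows "1 \<in> mod_prod ((\<lambda>s. s / f) ` S) V \<longleftrightarrow> f \<in> mod_prod S V"
proof
  assume "1 \<in> mod_prod ((\<lambda>s. s / f) ` S) V"
  from mod_prod_image_mult[OF this, of f] show "f \<in> mod_prod S V"
    using assms by (simp add: image_image)
next
  assume "f \<in> mod_prod S V"
  from mod_prod_image_mult[OF this, of "inverse f"]
  show "1 \<in> mod_prod ((\<lambda>s. s / f) ` S) V"
    using assms by (simp add: divide_inverse mult.commute[of "inverse f"])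
qed

lemma mod_prod_mod_prod:
  assumes "is_subring D" "is_subring V" "D \<subseteq> V"
  shows "mod_prod (mod_prod S D) V = mod_prod S V"
proof
  show "mod_prod (mod_prod S D) V \<subseteq> mod_prod S V"
  proof
    fix x assume "x \<in> mod_prod (mod_prod S D) V"
    then show "x \<in> mod_prod S V"
    proof (induction rule: mod_prod_induct)
      case (step e v y)
      have "e \<in> mod_prod S V" using step assms(3) mod_prod_mono[of S S D V] by blast
      then have "v * e \<in> mod_prod S V" using step assms(2) mod_prod_scale by blast
      then show ?case using step by (simp add: mod_prod_add mult.commute)
    qed (simp add: zero_in_mod_prod)
  qed
  have "s \<in> mod_prod S D" if "s \<in> S" for s
    using mult_in_mod_prod[OF that, of 1 D] assms(1) by (simp add: is_subring_def)
  then show "mod_prod S V \<subseteq> mod_prod (mod_prod S D) V"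
    by (intro mod_prod_mono) auto
qed

text \<open>
  A sum of products in which generators may repeat can be collected into one coefficient for each
  generator.
\<close>

lemma fg_submodules_eq:
  assumes "is_subring D"
  shows "fg_submodules D = {mod_prod S D | S. finite S}"
proof -
  have eq: "{x. \<exists>c. (\<forall>s\<in>S. c s \<in> D) \<and> x = (\<Sum>s\<in>S. c s * s)} = mod_prod S D" (is "?L = _")
    if "finite S" for S
  proof
    show "?L \<subseteq> mod_prod S D"
      by (auto intro!: mod_prod_sum simp: mult.commute mult_in_mod_prod)
    show "mod_prod S D \<subseteq> ?L"
    proof
      fix x assume "x \<in> mod_prod S D"
      then show "x \<in> ?L"
      proof (induction rule: mod_prod_induct)
        case zero
        show ?case using assms by (auto simp: is_subring_def intro!: exI[of _ "\<lambda>_. 0"])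
      next
        case (step e v y)
        then obtain c where c: "\<forall>s\<in>S. c s \<in> D" "y = (\<Sum>s\<in>S. c s * s)" by blast
        have "(\<Sum>s\<in>S. (c(e := c e + v)) s * s) = (\<Sum>s\<in>S. c s * s + (if s = e then v * e else 0))"
          by (intro sum.cong) (auto simp: algebra_simps)
        also have "\<dots> = e * v + y"
          using that step c by (simp add: sum.distrib algebra_simps)
        finally show ?case
          using c(1) step assms
          by (intro CollectI exI[of _ "c(e := c e + v)"]) (auto simp: is_subring_def)
      qed
    qed
  qed
  show ?thesis
    unfolding fg_submodules_def
    by (intro Collect_cong ex_cong1, subst conj_commute, rule conj_cong) (simp_all only: eq)
qed

lemma mod_prod_finitary:
  assumes "x \<in> mod_prod E (subring_gen S)"
  shows "\<exists>X. finite X \<and> X \<subseteq> S \<and> x \<in> mod_prod E (subring_gen X)"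
  using assms
proof (induction rule: mod_prod_induct)
  case zero
  show ?case by (intro exI[of _ "{}"]) (simp add: zero_in_mod_prod)
next
  case (step e v y)
  then obtain X where X: "finite X" "X \<subseteq> S" "y \<in> mod_prod E (subring_gen X)" by blast
  obtain X' where X': "finite X'" "X' \<subseteq> S" "v \<in> subring_gen X'"
    using subring_gen_finitary[OF step(2)] by blast
  have "v \<in> subring_gen (X \<union> X')" "y \<in> mod_prod E (subring_gen (X \<union> X'))"
    using X(3) X'(3) subring_gen_mono[of X' "X \<union> X'"]
      mod_prod_mono[OF order_refl subring_gen_mono[of X "X \<union> X'"]] by auto
  then show ?case
    using step(1) X X' by (intro exI[of _ "X \<union> X'"]) (auto intro: mod_prod_step)
qed

section \<open>Extension to valuation rings\<close>

lemma subring_gen_insert_poly: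
  assumes A: "is_subring A" and "w \<in> subring_gen (insert z A)"
  shows "\<exists>p. (\<forall>i. coeff p i \<in> A) \<and> w = poly p z"
  using assms(2)
proof induction
  case (gen_base x)
  show ?case
  proof (cases "x = z")
    case True
    have "\<forall>i. coeff [:0, 1:] i \<in> A"
      using A by (auto simp: is_subring_def coeff_pCons split: nat.split)
    with True show ?thesis by (intro exI[of _ "[:0, 1:]"]) simp
  next
    case False
    with gen_base have "\<forall>i. coeff [:x:] i \<in> A"
      using A by (auto simp: is_subring_def coeff_pCons split: nat.split)
    then show ?thesis by (intro exI[of _ "[:x:]"]) simp
  qed
next
  case gen_zero
  show ?case using A by (intro exI[of _ 0]) (simp add: is_subring_def)
next
  case gen_one
  show ?case using A by (intro exI[of _ 1]) (simp add: is_subring_def coeff_1)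
next
  case (gen_add x y)
  then obtain p q where "\<forall>i. coeff p i \<in> A" "x = poly p z" "\<forall>i. coeff q i \<in> A" "y = poly q z"
    by blast
  then show ?case using A by (intro exI[of _ "p + q"]) (simp add: is_subring_def)
next
  case (gen_mult x y)
  then obtain p q where "\<forall>i. coeff p i \<in> A" "x = poly p z" "\<forall>i. coeff q i \<in> A" "y = poly q z"
    by blast
  then show ?case using A
    by (intro exI[of _ "p * q"]) (auto simp: coeff_mult intro!: subring_sum, simp add: is_subring_def)
next
  case (gen_minus x)
  then obtain p where "\<forall>i. coeff p i \<in> A" "x = poly p z"
    by blast
  then show ?case using A by (intro exI[of _ "- p"]) (auto simp: is_subring_def)
qed

lemma mod_prod_insert_poly:
  assumes A: "is_subring A" and "w \<in> mod_prod Y (subring_gen (insert z A))"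
  shows "\<exists>p. (\<forall>i. coeff p i \<in> mod_prod Y A) \<and> w = poly p z"
  using assms(2)
proof (induction rule: mod_prod_induct)
  case zero
  show ?case by (intro exI[of _ 0]) (simp add: zero_in_mod_prod)
next
  case (step e v y)
  then obtain p where p: "\<forall>i. coeff p i \<in> mod_prod Y A" "y = poly p z" by blast
  obtain q where q: "\<forall>i. coeff q i \<in> A" "v = poly q z"
    using subring_gen_insert_poly[OF A step(2)] by blast
  show ?case
    using p q step(1) by (intro exI[of _ "smult e q + p"]) (auto intro: mod_prod_step)
qed

text \<open>
  The reduction step of Chevalley's theorem. Write \<open>I\<close> for the ideal \<open>mod_prod Y A\<close> and \<open>b\<^sub>0\<close> for the
  constant coefficient of \<open>q\<close>. As \<open>1 - b\<^sub>0\<close> is a unit of \<open>A\<close>, the relation \<open>q(1/z) = 1\<close> multiplied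
  by \<open>z\<^sup>n\<close>, where \<open>n = degree p\<close>, expresses \<open>z\<^sup>n\<close> by lower powers of \<open>z\<close> with coefficients in \<open>I\<close>.
  Substituting this for the leading power in \<open>p(z) = 1\<close> gives a relation of lower degree.
\<close>

lemma lower_degree_relation:
  assumes A: "is_subring A" and Y: "Y \<subseteq> A" and one: "1 \<notin> mod_prod Y A"
    and unit: "\<And>b. b \<in> mod_prod Y A \<Longrightarrow> inverse (1 - b) \<in> A"
    and z: "z \<noteq> 0"
    and p: "\<forall>i. coeff p i \<in> mod_prod Y A" "poly p z = 1"
    and q: "\<forall>i. coeff q i \<in> mod_prod Y A" "poly q (inverse z) = 1"
    and le: "degree q \<le> degree p"
  shows "\<exists>r. (\<forall>i. coeff r i \<in> mod_prod Y A) \<and> poly r z = 1 \<and> degree r < degree p"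
proof -
  define n where "n = degree p"
  define m where "m = degree q"
  define a where "a = coeff p n"
  define b0 where "b0 = coeff q 0"
  define w where "w = inverse (1 - b0)"
  have IA: "x \<in> A" if "x \<in> mod_prod Y A" for x
    using mod_prod_subset_ring[OF A Y] that by blast
  have b0: "b0 \<in> mod_prod Y A" "1 - b0 \<noteq> 0"
    using q(1) one unfolding b0_def by (auto simp: eq_iff_diff_eq_0[symmetric]) metis
  have w: "w \<in> A" "w * (1 - b0) = 1"
    using unit b0 by (auto simp: w_def)
  \<comment> \<open>a constant relation would put \<open>1\<close> into the ideal\<close>
  have n: "n > 0"
  proof (rule ccontr)
    assume "\<not> n > 0"
    then have "degree p = 0" by (simp add: n_def)
    then have "poly p z = coeff p 0" by (simp add: poly_altdef)
    then show False using p one by metis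
  qed
  have aw: "a * w \<in> A" using IA p(1) w(1) A by (auto simp: a_def is_subring_def)
  \<comment> \<open>\<open>p\<close> with its leading term replaced by means of
    \<open>z\<^sup>n = w \<Sum>\<^sub>j b\<^sub>j z\<^bsup>n-j\<^esup>\<close>, the sum being over \<open>1 \<le> j \<le> m\<close>; no exponent is truncated, since
    \<open>m \<le> n\<close>\<close>
  define r where "r = p - monom a n + (\<Sum>j=1..m. monom (a * w * coeff q j) (n - j))"
  have "coeff r i \<in> mod_prod Y A" for i
    unfolding r_def coeff_add coeff_diff coeff_sum coeff_monom
    using p(1) q(1) aw A
    by (intro mod_prod_add mod_prod_diff mod_prod_sum)
      (auto simp: a_def zero_in_mod_prod intro: mod_prod_scale)
  moreover have "poly r z = 1"
  proof -
    have "(\<Sum>j=1..m. coeff q j * z ^ (n - j)) = (\<Sum>j=1..m. z ^ n * (coeff q j * inverse z ^ j))"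
      using le z by (intro sum.cong) (auto simp: n_def m_def power_diff field_simps)
    also have "\<dots> = z ^ n * ((\<Sum>j\<le>m. coeff q j * inverse z ^ j) - b0)"
      by (simp add: sum_distrib_left[symmetric] b0_def atMost_atLeast0 sum.atLeast_Suc_atMost)
    also have "\<dots> = z ^ n * (1 - b0)"
      using q(2) by (simp add: poly_altdef m_def)
    finally have s: "(\<Sum>j=1..m. coeff q j * z ^ (n - j)) = z ^ n * (1 - b0)" .
    have "poly r z = 1 - a * z ^ n + a * w * (\<Sum>j=1..m. coeff q j * z ^ (n - j))"
      by (simp add: r_def poly_sum poly_monom p(2) sum_distrib_left mult.assoc)
    also have "\<dots> = 1 - a * z ^ n + a * z ^ n * (w * (1 - b0))"
      by (simp only: s) (simp add: ac_simps)
    finally show ?thesis using w by simp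
  qed
  moreover have "degree r < n"
  proof -
    have "coeff r i = 0" if "i \<ge> n" for i
    proof -
      have "coeff p i - (if n = i then a else 0) = 0"
        using that by (auto simp: a_def n_def coeff_eq_0)
      moreover have "(\<Sum>j=1..m. if n - j = i then a * w * coeff q j else 0) = 0"
        using that n by (intro sum.neutral) auto
      ultimately show ?thesis by (simp add: r_def coeff_sum)
    qed
    then have "degree r \<le> n - 1" by (intro degree_le) (auto)
    then show ?thesis using n by simp
  qed
  ultimately show ?thesis unfolding n_def by blast
qed

text \<open>
  The polynomial of larger degree can always be replaced by one of smaller degree, since the situation
  is symmetric in \<open>z\<close> and \<open>1/z\<close>; so the sum of the two degrees would decrease forever.
\<close>

lemma no_opposite_relations:
  assumes A: "is_subring A" and Y: "Y \<subseteq> A" and one: "1 \<notin> mod_prod Y A"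
    and unit: "\<And>b. b \<in> mod_prod Y A \<Longrightarrow> inverse (1 - b) \<in> A"
    and "z \<noteq> 0"
    and "\<forall>i. coeff p i \<in> mod_prod Y A" "poly p z = 1"
    and "\<forall>i. coeff q i \<in> mod_prod Y A" "poly q (inverse z) = 1"
  shows False
  using assms(5-)
proof (induction "degree p + degree q" arbitrary: p q rule: less_induct)
  case less
  show False
  proof (cases "degree q \<le> degree p")
    case True
    then obtain r where "\<forall>i. coeff r i \<in> mod_prod Y A" "poly r z = 1" "degree r < degree p"
      using lower_degree_relation[OF A Y one unit less.prems] by blast
    then show False using less by (metis add_less_mono1)
  next
    case False
    then obtain r where "\<forall>i. coeff r i \<in> mod_prod Y A" "poly r (inverse z) = 1"
        "degree r < degree q"
      using lower_degree_relation[OF A Y one unit, of "inverse z" q p] less.prems by auto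
    then show False using less by (metis add_strict_left_mono)
  qed
qed

text \<open>
  Chevalley's extension theorem. Zorn's lemma gives a ring \<open>A \<supseteq> R\<close> that is maximal among those in which
  \<open>Y\<close> does not generate the unit ideal. Maximality means that adjoining any \<open>z \<notin> A\<close> produces a
  relation \<open>p(z) = 1\<close> with coefficients in the ideal \<open>I\<close> generated by \<open>Y\<close>. Applied to
  \<open>z = 1/(1 - b)\<close> with \<open>b \<in> I\<close>, it shows that \<open>1 - b\<close> is a unit of \<open>A\<close>; applied to both \<open>z\<close> and
  \<open>1/z\<close>, it then contradicts \<open>no_opposite_relations\<close>.
\<close>

lemma valuation_extension:
  assumes R: "is_subring R" and Y: "Y \<subseteq> R" and one: "1 \<notin> mod_prod Y R"
  obtains V where "V \<in> Zar R" "1 \<notin> mod_prod Y V"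
proof -
  let ?\<A> = "{A. is_subring A \<and> R \<subseteq> A \<and> 1 \<notin> mod_prod Y A}"
  have "\<exists>M\<in>?\<A>. \<forall>X\<in>?\<A>. M \<subseteq> X \<longrightarrow> X = M"
  proof (rule subset_Zorn_nonempty)
    show "?\<A> \<noteq> {}" using R one by blast
  next
    fix C assume ne: "C \<noteq> {}" and C: "subset.chain ?\<A> C"
    then have sub: "\<And>A. A \<in> C \<Longrightarrow> is_subring A \<and> R \<subseteq> A \<and> 1 \<notin> mod_prod Y A"
      by (auto simp: subset_chain_def)
    \<comment> \<open>finitely many elements of the union already lie in one member of the chain\<close>
    have dir: "\<exists>B\<in>C. X \<subseteq> B" if "finite X" "X \<subseteq> \<Union>C" for X
      using finite_subset_Union_chain[OF that ne C] by metis
    have "is_subring (\<Union>C)"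
      unfolding is_subring_def
    proof (intro conjI ballI)
      show "0 \<in> \<Union>C" "1 \<in> \<Union>C" using ne sub by (auto simp: is_subring_def)
      fix x y assume "x \<in> \<Union>C" "y \<in> \<Union>C"
      then obtain B where B: "B \<in> C" "x \<in> B" "y \<in> B" using dir[of "{x, y}"] by auto
      then show "x + y \<in> \<Union>C" "x * y \<in> \<Union>C" "- x \<in> \<Union>C"
        using sub[OF B(1)] unfolding is_subring_def by blast+
    qed
    moreover have "R \<subseteq> \<Union>C" using ne sub by blast
    moreover have "1 \<notin> mod_prod Y (\<Union>C)"
    proof
      assume "1 \<in> mod_prod Y (\<Union>C)"
      then obtain n e v where *: "\<forall>i<n. e i \<in> Y \<and> v i \<in> \<Union>C" "1 = (\<Sum>i<n::nat. e i * v i)"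
        unfolding mod_prod_def by blast
      then obtain B where B: "B \<in> C" "v ` {..<n} \<subseteq> B" using dir[of "v ` {..<n}"] by auto
      with * have "1 \<in> mod_prod Y B" unfolding mod_prod_def by blast
      then show False using sub[OF B(1)] by blast
    qed
    ultimately show "\<Union>C \<in> ?\<A>" by blast
  qed
  then obtain A where "A \<in> ?\<A>" and max': "\<forall>X\<in>?\<A>. A \<subseteq> X \<longrightarrow> X = A" ..
  then have A: "is_subring A" "R \<subseteq> A" "1 \<notin> mod_prod Y A" by simp_all
  have max: "X = A" if "is_subring X" "R \<subseteq> X" "1 \<notin> mod_prod Y X" "A \<subseteq> X" for X
    using max' that by simp
  have YA: "Y \<subseteq> A" using Y A(2) by blast
  have rel: "\<exists>p. (\<forall>i. coeff p i \<in> mod_prod Y A) \<and> poly p z = 1" if "z \<notin> A" for z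
  proof -
    let ?B = "subring_gen (insert z A)"
    have "insert z A \<subseteq> ?B" by (rule subset_subring_gen)
    then have "?B \<noteq> A" "A \<subseteq> ?B" using that by auto
    then have "1 \<in> mod_prod Y ?B"
      using max[of ?B] is_subring_subring_gen A(2) by blast
    from mod_prod_insert_poly[OF A(1) this] show ?thesis by metis
  qed
  have unit: "inverse (1 - b) \<in> A" if b: "b \<in> mod_prod Y A" for b
  proof (rule ccontr)
    assume "inverse (1 - b) \<notin> A"
    then obtain p where p: "\<forall>i. coeff p i \<in> mod_prod Y A" "poly p (inverse (1 - b)) = 1"
      using rel by blast
    have nz: "1 - b \<noteq> 0" using b A(3) by auto
    have "b \<in> A" using b mod_prod_subset_ring[OF A(1) YA] by blast
    then have tA: "1 - b \<in> A"
      using A(1) unfolding is_subring_def by (metis diff_conv_add_uminus)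
    \<comment> \<open>clearing denominators in the relation \<open>p(1/(1 - b)) = 1\<close>: some power of \<open>1 - b\<close> lies in the
      ideal, although it is congruent to \<open>1\<close> modulo that ideal\<close>
    have "\<exists>n. (1 - b) ^ n * poly p (inverse (1 - b)) \<in> mod_prod Y A"
      using p(1)
    proof (induction p rule: pCons_induct)
      case 0
      show ?case by (simp add: zero_in_mod_prod)
    next
      case (pCons a p)
      have a: "a \<in> mod_prod Y A" using pCons.prems[rule_format, of 0] by simp
      have "\<forall>i. coeff p i \<in> mod_prod Y A"
        using pCons.prems by (metis coeff_pCons_Suc)
      then obtain n where n: "(1 - b) ^ n * poly p (inverse (1 - b)) \<in> mod_prod Y A"
        using pCons.IH by blast
      have "(1 - b) ^ Suc n * poly (pCons a p) (inverse (1 - b))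
          = (1 - b) ^ Suc n * a + (1 - b) ^ n * poly p (inverse (1 - b))"
        using nz by (simp add: field_simps)
      moreover have "(1 - b) ^ Suc n * a \<in> mod_prod Y A"
        using mod_prod_scale[OF A(1) subring_power[OF A(1) tA] a] .
      ultimately show ?case using n mod_prod_add by metis
    qed
    then obtain n where n: "(1 - b) ^ n \<in> mod_prod Y A" using p(2) by auto
    have "1 - (1 - b) ^ k \<in> mod_prod Y A" for k
    proof (induction k)
      case (Suc k)
      have "1 - (1 - b) ^ Suc k = (1 - b) * (1 - (1 - b) ^ k) + b"
        by (simp add: algebra_simps)
      then show ?case using Suc tA b A(1) by (simp only: mod_prod_add mod_prod_scale)
    qed (simp add: zero_in_mod_prod)
    from mod_prod_add[OF n this[of n]] A(3) show False by simp
  qed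
  have "z \<in> A \<or> inverse z \<in> A" if "z \<noteq> 0" for z
    using no_opposite_relations[OF A(1) YA A(3) unit that] rel by meson
  then have "A \<in> Zar R"
    using A by (auto simp: Zar_def overrings_def)
  with A(3) that show thesis by blast
qed

section \<open>An algebraic criterion for membership in the closure\<close>

text \<open>
  Dividing by \<open>f\<close>, the right-hand side says that the elements \<open>s / f\<close> generate the unit ideal in the
  ring obtained from \<open>T\<close> by adjoining them. Valuation rings over \<open>T\<close> that miss one of these elements
  need not be considered, because \<open>f\<close> lies in the extension of \<open>S\<close> to such a ring anyway.
\<close>

lemma b_closure_iff:
  assumes D: "is_subring D" and T: "T \<in> overrings D" and f: "f \<noteq> 0"
  shows "f \<in> b_closure T (mod_prod S D) \<longleftrightarrow>
    f \<in> mod_prod S (subring_gen (T \<union> (\<lambda>s. s / f) ` S))"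
proof
  let ?Y = "(\<lambda>s. s / f) ` S" and ?R = "subring_gen (T \<union> (\<lambda>s. s / f) ` S)"
  have base: "T \<union> ?Y \<subseteq> ?R" by (rule subset_subring_gen)
  {
    assume *: "f \<in> b_closure T (mod_prod S D)"
    show "f \<in> mod_prod S ?R"
    proof (rule ccontr)
      assume "f \<notin> mod_prod S ?R"
      then have "1 \<notin> mod_prod ?Y ?R" using f by (simp add: one_in_mod_prod_divide_iff)
      moreover have "?Y \<subseteq> ?R" using base by blast
      ultimately obtain V where V: "V \<in> Zar ?R" "1 \<notin> mod_prod ?Y V"
        using valuation_extension[OF is_subring_subring_gen] by metis
      have "V \<in> Zar T" "is_subring V" "D \<subseteq> V"
        using V(1) base T by (auto simp: Zar_def overrings_def)
      then have "f \<in> mod_prod S V"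
        using * mod_prod_mod_prod[OF D] by (auto simp: b_closure_def)
      then show False using V(2) f by (simp add: one_in_mod_prod_divide_iff)
    qed
  }
  assume *: "f \<in> mod_prod S ?R"
  show "f \<in> b_closure T (mod_prod S D)"
    unfolding b_closure_def
  proof
    fix V assume V: "V \<in> Zar T"
    then have sub: "is_subring V" "T \<subseteq> V" "D \<subseteq> V"
      using T by (auto simp: Zar_def overrings_def)
    have "f \<in> mod_prod S V"
    proof (cases "?Y \<subseteq> V")
      case True
      then have "?R \<subseteq> V" using sub by (intro subring_gen_least) auto
      then show ?thesis using * mod_prod_mono[OF order_refl] by blast
    next
      case False
      then obtain s where s: "s \<in> S" "s / f \<notin> V" by blast
      moreover have "s \<noteq> 0" using s sub(1) by (auto simp: is_subring_def)
      moreover have "s / f \<noteq> 0" using f \<open>s \<noteq> 0\<close> by simp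
      then have "s / f \<in> V \<or> inverse (s / f) \<in> V"
        using V unfolding Zar_def by blast
      ultimately have "f / s \<in> V" by simp
      with s(1) have "s * (f / s) \<in> mod_prod S V"
        by (rule mult_in_mod_prod)
      then show ?thesis using \<open>s \<noteq> 0\<close> by simp
    qed
    then show "f \<in> mod_prod (mod_prod S D) V"
      using mod_prod_mod_prod[OF D sub(1,3)] by simp
  qed
qed

lemma zero_in_b_closure: "0 \<in> b_closure T E"
  by (simp add: b_closure_def zero_in_mod_prod)

text \<open>
  The closure is a \<open>D\<close>-module, so containing a module can be tested on generators.
\<close>

lemma mod_prod_subset_b_closure_iff:
  assumes D: "is_subring D" and T: "T \<in> overrings D"
  shows "mod_prod S D \<subseteq> b_closure T E \<longleftrightarrow> S \<subseteq> b_closure T E"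
proof
  have "s \<in> mod_prod S D" if "s \<in> S" for s
    using mult_in_mod_prod[OF that, of 1 D] D by (simp add: is_subring_def)
  then show "mod_prod S D \<subseteq> b_closure T E \<Longrightarrow> S \<subseteq> b_closure T E" by blast
next
  assume S: "S \<subseteq> b_closure T E"
  show "mod_prod S D \<subseteq> b_closure T E"
    unfolding b_closure_def
  proof (intro subsetI INT_I)
    fix x V assume x: "x \<in> mod_prod S D" and V: "V \<in> Zar T"
    have V': "is_subring V" "D \<subseteq> V"
      using V T by (auto simp: Zar_def overrings_def)
    show "x \<in> mod_prod E V"
      using x
    proof (induction rule: mod_prod_induct)
      case (step e v y)
      then have "e \<in> mod_prod E V" "v \<in> V"
        using S V V' by (auto simp: b_closure_def)
      from mod_prod_scale[OF V'(1) this(2,1)] show ?case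
        using step by (simp add: mod_prod_add mult.commute)
    qed (simp add: zero_in_mod_prod)
  qed
qed

section \<open>Comparison of the two topologies\<close>

text \<open>
  If \<open>x = p(1/x)\<close> with \<open>p\<close> over \<open>T\<close>, then multiplying by a power \<open>x\<^sup>n\<close> that clears the denominators
  gives \<open>x\<^bsup>n+1\<^esup> = r(x)\<close> with \<open>degree r \<le> n\<close>, which is an integral equation.
\<close>

lemma integral_over_if_in_gen_inverse:
  fixes x :: "'k::field"
  assumes T: "is_subring T" and x: "x \<noteq> 0" "x \<in> subring_gen (insert (inverse x) T)"
  shows "integral_over T x"
proof -
  have clear: "\<exists>n r. (\<forall>i. coeff r i \<in> T) \<and> degree r \<le> n \<and> x ^ n * poly p (inverse x) = poly r x"
    if "\<forall>i. coeff p i \<in> T" for p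
    using that
  proof (induction p rule: pCons_induct)
    case 0
    show ?case using T by (auto simp: is_subring_def intro!: exI[of _ 0])
  next
    case (pCons a p)
    have a: "a \<in> T" using pCons.prems[rule_format, of 0] by simp
    have "\<forall>i. coeff p i \<in> T" using pCons.prems by (metis coeff_pCons_Suc)
    then obtain n r where r: "\<forall>i. coeff r i \<in> T" "degree r \<le> n"
      "x ^ n * poly p (inverse x) = poly r x"
      using pCons.IH by blast
    have "x ^ Suc n * poly (pCons a p) (inverse x) = a * x ^ Suc n + x ^ n * poly p (inverse x)"
      using x(1) by (simp add: field_simps)
    also have "\<dots> = poly (monom a (Suc n) + r) x" by (simp add: poly_monom r(3))
    finally have "x ^ Suc n * poly (pCons a p) (inverse x) = poly (monom a (Suc n) + r) x" .
    moreover have "\<forall>i. coeff (monom a (Suc n) + r) i \<in> T"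
      using a r(1) T by (auto simp: is_subring_def)
    moreover have "degree (monom a (Suc n) + r) \<le> Suc n"
      using r(2) by (intro degree_add_le degree_monom_le) auto
    ultimately show ?case by blast
  qed
  obtain p where p: "\<forall>i. coeff p i \<in> T" "x = poly p (inverse x)"
    using subring_gen_insert_poly[OF T x(2)] by blast
  obtain n r where r: "\<forall>i. coeff r i \<in> T" "degree r \<le> n" "x ^ n * x = poly r x"
    using clear[OF p(1)] p(2) by metis
  let ?h = "monom 1 (Suc n) - r"
  have "degree r < degree (monom (1::'k) (Suc n))" using r(2) by (simp add: degree_monom_eq)
  then have "degree ?h = Suc n" 
    by (simp add: degree_monom_eq degree_add_eq_left[of "- r" "monom 1 (Suc n)", simplified])
  moreover have "coeff r (Suc n) = 0" using r(2) by (simp add: coeff_eq_0)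
  ultimately have "lead_coeff ?h = 1" by simp
  moreover have "\<forall>i. coeff ?h i \<in> T"
  proof
    fix i
    have "(if Suc n = i then 1 else 0) \<in> T" "- coeff r i \<in> T"
      using r(1) T unfolding is_subring_def by auto
    then have "(if Suc n = i then 1 else 0) + - coeff r i \<in> T"
      using T unfolding is_subring_def by blast
    then show "coeff ?h i \<in> T" by simp
  qed
  moreover have "poly ?h x = 0" using r(3) by (simp add: poly_monom mult.commute)
  ultimately show ?thesis unfolding integral_over_def by blast
qed

text \<open>
  Krull's theorem that an integrally closed domain is the intersection of its valuation overrings:
  every such \<open>V\<close> contains \<open>D\<close>, so \<open>DV = V\<close>.
\<close>

lemma b_closure_base_ring:
  assumes D: "is_subring D" and T: "T \<in> Overr_ic D"
  shows "b_closure T D = T"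
proof -
  have T': "T \<in> overrings D" "is_subring T" "integrally_closed T"
    using T by (auto simp: Overr_ic_def overrings_def)
  have "x \<in> b_closure T D \<longleftrightarrow> x \<in> T" if x: "x \<noteq> 0" for x
  proof -
    let ?R = "subring_gen (insert (inverse x) T)"
    have "x \<in> b_closure T D \<longleftrightarrow> x \<in> ?R"
      using b_closure_iff[OF D T'(1) x, of "{1}"]
      by (simp add: mod_prod_one D is_subring_subring_gen inverse_eq_divide)
    moreover have "x \<in> T" if "x \<in> ?R"
      using integral_over_if_in_gen_inverse[OF T'(2) x that] T'(3)
      by (simp add: integrally_closed_def)
    ultimately show ?thesis
      using subset_subring_gen[of "insert (inverse x) T"] by blast
  qed
  moreover have "0 \<in> T" using T' by (simp add: is_subring_def)
  ultimately have "x \<in> b_closure T D \<longleftrightarrow> x \<in> T" for x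
    using zero_in_b_closure by (cases "x = 0") auto
  then show ?thesis by blast
qed

text \<open>
  For \<open>x \<noteq> 0\<close> this is the subbasic open set of \<open>F = Dx\<close> and \<open>G = D\<close>. For \<open>x = 0\<close> the module \<open>Dx\<close> is
  zero and cannot be used, but the set is the whole space.
\<close>

lemma openin_b_topology_element:
  assumes D: "is_subring D"
  shows "openin (b_topology D) {T \<in> Overr_ic D. x \<in> T}"
proof (cases "x = 0")
  case True
  then have "{T \<in> Overr_ic D. x \<in> T} = Overr_ic D"
    by (auto simp: Overr_ic_def overrings_def is_subring_def)
  then show ?thesis
    using openin_topspace[of "b_topology D"] topspace_b_topology[OF D] by simp
next
  case False
  have "mod_prod {y} D \<in> fg_submodules D" for y
    unfolding fg_submodules_eq[OF D] by blast
  from this[of x] this[of 1] have "mod_prod {x} D \<in> fg_submodules D" "D \<in> fg_submodules D"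
    by (simp_all add: mod_prod_one D)
  moreover have "D \<noteq> {0}" using D by (auto simp: is_subring_def)
  moreover have "mod_prod {x} D \<noteq> {0}"
    using mult_in_mod_prod[of x "{x}" 1 D] D False by (auto simp: is_subring_def)
  ultimately have "openin (b_topology D) (U_ic D (mod_prod {x} D) D)"
    unfolding b_topology_def by (intro topology_generated_by_Basis) blast
  moreover have "U_ic D (mod_prod {x} D) D = {T \<in> Overr_ic D. x \<in> T}"
  proof -
    have "mod_prod {x} D \<subseteq> b_closure T D \<longleftrightarrow> x \<in> T" if "T \<in> Overr_ic D" for T
      using that mod_prod_subset_b_closure_iff[OF D, of T "{x}" D] b_closure_base_ring[OF D that]
      by (simp add: Overr_ic_def)
    then show ?thesis by (auto simp: U_ic_def)
  qed
  ultimately show ?thesis by simp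
qed

lemma openin_b_topology_zariski_basic_open:
  assumes D: "is_subring D" and "finite X"
  shows "openin (b_topology D) (zariski_basic_open D X)"
  using assms(2)
proof induction
  case empty
  then show ?case
    using openin_topspace[of "b_topology D"] topspace_b_topology[OF D]
    by (simp add: zariski_basic_open_def)
next
  case (insert x X)
  have "zariski_basic_open D (insert x X) =
      {T \<in> Overr_ic D. x \<in> T} \<inter> zariski_basic_open D X"
    by (auto simp: zariski_basic_open_def)
  then show ?case
    using insert openin_b_topology_element[OF D] by auto
qed

text \<open>
  Membership in the closure for \<open>T\<close> is witnessed by one relation over \<open>T[s/f | s \<in> S]\<close>. The elements
  of \<open>T\<close> that occur in it form \<open>X\<close>; the adjoined elements \<open>s/f\<close> do not depend on \<open>T\<close>.
\<close>

lemma b_closure_spreads: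
  assumes D: "is_subring D" and T: "T \<in> overrings D"
    and f: "f \<in> b_closure T (mod_prod S D)"
  shows "\<exists>X. finite X \<and> X \<subseteq> T \<and>
    (\<forall>T'\<in>overrings D. X \<subseteq> T' \<longrightarrow> f \<in> b_closure T' (mod_prod S D))"
proof (cases "f = 0")
  case True
  then show ?thesis by (intro exI[of _ "{}"]) (simp add: zero_in_b_closure)
next
  case False
  let ?Y = "(\<lambda>s. s / f) ` S"
  have "f \<in> mod_prod S (subring_gen (T \<union> ?Y))"
    using f b_closure_iff[OF D T False] by simp
  from mod_prod_finitary[OF this]
  obtain X where X: "finite X" "X \<subseteq> T \<union> ?Y" "f \<in> mod_prod S (subring_gen X)"
    by metis
  have "f \<in> b_closure T' (mod_prod S D)" if T': "T' \<in> overrings D" "X \<inter> T \<subseteq> T'" for T'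
  proof -
    have "X \<subseteq> T' \<union> ?Y" using X(2) T'(2) by blast
    then have "mod_prod S (subring_gen X) \<subseteq> mod_prod S (subring_gen (T' \<union> ?Y))"
      by (intro mod_prod_mono subring_gen_mono) simp
    with X(3) show ?thesis using b_closure_iff[OF D T'(1) False] by blast
  qed
  then show ?thesis using X(1) by (intro exI[of _ "X \<inter> T"]) auto
qed

lemma openin_zariski_topology_U_ic:
  assumes D: "is_subring D" and "F \<in> fg_submodules D" "G \<in> fg_submodules D"
  shows "openin (zariski_topology D) (U_ic D F G)"
proof -
  obtain P S where P: "finite P" "F = mod_prod P D" and G: "G = mod_prod S D"
    using assms(2,3) unfolding fg_submodules_eq[OF D] by blast
  have U: "T \<in> U_ic D F G \<longleftrightarrow> T \<in> Overr_ic D \<and> P \<subseteq> b_closure T G" for T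
    using mod_prod_subset_b_closure_iff[OF D] by (auto simp: U_ic_def Overr_ic_def P(2))
  show ?thesis
  proof (subst openin_subopen, intro ballI)
    fix T assume T: "T \<in> U_ic D F G"
    then have T': "T \<in> Overr_ic D" "T \<in> overrings D" "P \<subseteq> b_closure T G"
      unfolding U by (auto simp: Overr_ic_def)
    have "\<forall>f\<in>P. \<exists>X. finite X \<and> X \<subseteq> T \<and>
        (\<forall>T'\<in>overrings D. X \<subseteq> T' \<longrightarrow> f \<in> b_closure T' G)"
      using b_closure_spreads[OF D T'(2)] T'(3) unfolding G by blast
    then obtain X where X: "\<And>f. f \<in> P \<Longrightarrow> finite (X f) \<and> X f \<subseteq> T \<and>
        (\<forall>T'\<in>overrings D. X f \<subseteq> T' \<longrightarrow> f \<in> b_closure T' G)"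
      by metis
    let ?Z = "\<Union>f\<in>P. X f"
    have "finite ?Z" using P(1) X by blast
    then have "openin (zariski_topology D) (zariski_basic_open D ?Z)"
      unfolding zariski_topology_def by (intro topology_generated_by_Basis) blast
    moreover have "T \<in> zariski_basic_open D ?Z"
      using X T'(1) by (auto simp: zariski_basic_open_def)
    moreover have "zariski_basic_open D ?Z \<subseteq> U_ic D F G"
    proof
      fix T' assume "T' \<in> zariski_basic_open D ?Z"
      then show "T' \<in> U_ic D F G"
        unfolding U using X by (auto simp: zariski_basic_open_def Overr_ic_def UN_subset_iff)
    qed
    ultimately show "\<exists>W. openin (zariski_topology D) W \<and> T \<in> W \<and> W \<subseteq> U_ic D F G"
      by blast
  qed
qed

theorem corollary5p5:
  fixes D :: "'k::field set"
  assumes "is_subring D"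
    and "quotient_field_is_UNIV D"
  shows "b_topology D = zariski_topology D"
proof -
  have "openin (zariski_topology D) U" if "openin (b_topology D) U" for U
  proof (rule generate_topology_on_coarsest[where T = "openin (zariski_topology D)"])
    show "generate_topology_on {U_ic D F G | F G.
        F \<in> fg_submodules D \<and> F \<noteq> {0} \<and> G \<in> fg_submodules D \<and> G \<noteq> {0}} U"
      using that unfolding b_topology_def by (rule openin_topology_generated_by)
  qed (auto intro: openin_zariski_topology_U_ic[OF assms(1)])
  moreover have "openin (b_topology D) U" if "openin (zariski_topology D) U" for U
  proof (rule generate_topology_on_coarsest[where T = "openin (b_topology D)"])
    show "generate_topology_on {zariski_basic_open D X | X. finite X} U"
      using that unfolding zariski_topology_def by (rule openin_topology_generated_by)
  qed (auto intro: openin_b_topology_zariski_basic_open[OF assms(1)])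
  ultimately show ?thesis
    using topology_eq by blast
qed

end
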